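(* Let $X$ be a subspace of $2^\omega$, let $Y=2^\omega\setminus X$, let $\mathcal{H}$ be a subgroup of $\mathcal{H}(2^\omega)$, and let $D$ be a countable dense subset of $2^\omega$ such that $D\subseteq Y$ and $D\cap Q=\varnothing$. Let $\mathcal{G}$ be the collection of all homeomorphisms $g:\mathrm{dom}(g)\to\mathrm{ran}(g)$ such that $\mathrm{dom}(g)$ and $\mathrm{ran}(g)$ are $G_\delta$ subspaces of $2^\omega$. Assume that the following conditions hold. (1) $\mathcal{H}[X]=X$. (2) If $h\in\mathcal{H}\setminus\{\mathrm{id}\}$ then $h[D]\cap D=\varnothing$. (3) For every $g\in\mathcal{G}$: if for every subgroup $\mathcal{S}$ of $\mathcal{H}$ with $|\mathcal{S}|<\mathsf{add(meager)}$ we have $|\{x\in\mathrm{dom}(g):g(x)\notin\mathcal{S}(x)\}|=\mathfrak{c}$, then there exists $z\in\mathrm{dom}(g)\cap X$ such that $g(z)\notin X$. Then there exists a subspace $X^\ast$ of $2^\omega$, homeomorphic to $X$, such that $2^\omega\setminus X^\ast$ is dense in $2^\omega$ and rigid.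
   Context: $2^\omega$ is the Cantor set with the product topology. For a space $Z$, $\mathcal{H}(Z)$ denotes the group of homeomorphisms of $Z$ onto itself under composition; a space $Z$ is rigid if $\mathcal{H}(Z)=\{\mathrm{id}\}$. For a subgroup $\mathcal{H}$ of $\mathcal{H}(Z)$ and $X\subseteq Z$, $\mathcal{H}[X]=\bigcup_{h\in\mathcal{H}}h[X]$, and for $x\in Z$, $\mathcal{H}(x)=\mathcal{H}[\{x\}]=\{h(x):h\in\mathcal{H}\}$ (the same notation is used for any subgroup $\mathcal{S}$). $Q=\{x\in 2^\omega:\text{there exists }m\in\omega\text{ such that }x_n=x_m\text{ whenever }n\geq m\}$ is the set of eventually constant sequences. $\mathfrak{c}=2^{\aleph_0}$. $\mathsf{add(meager)}$ is the minimum cardinal $\kappa$ such that there exists a collection of size $\kappa$ of meager subsets of $2^\omega$ whose union is non-meager in $2^\omega$. *)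

theory Defs
  imports "HOL-Analysis.Analysis" "HOL-Algebra.Bij"
begin

unbundle cardinal_syntax

section \<open>The Cantor set\<close>

text \<open>The library topology on functions is the product topology, and on \<^typ>\<open>bool\<close> it is
  discrete. Subspaces are sets \<open>X\<close> carrying the topology \<open>top_of_set X\<close>.\<close>

type_synonym cantor = "nat \<Rightarrow> bool"

lemma cantor_topology:
  "(euclidean :: cantor topology) = product_topology (\<lambda>_. discrete_topology UNIV) UNIV"
proof -
  have "(euclidean :: bool topology) = discrete_topology UNIV"
    by (simp add: topology_eq open_discrete)
  then show ?thesis
    by (metis euclidean_product_topology)
qed

definition eventually_constant :: "cantor set" where
  "eventually_constant = {x. \<exists>m. \<forall>n\<ge>m. x n = x m}"


section \<open>Homeomorphism groups and rigidity\<close>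

text \<open>As in \<^const>\<open>BijGroup\<close>, functions are required to be extensional, so that every
  self-homeomorphism of \<open>X\<close> is represented by exactly one function.\<close>

definition homeo_group :: "'a topology \<Rightarrow> ('a \<Rightarrow> 'a) monoid" where
  "homeo_group X =
     (BijGroup (topspace X))
       \<lparr>carrier := {h \<in> extensional (topspace X). homeomorphic_map X X h}\<rparr>"

lemma subgroup_homeo_group:
  "subgroup (carrier (homeo_group X)) (BijGroup (topspace X))"
proof -
  interpret B: group "BijGroup (topspace X)" by (rule group_BijGroup)
  let ?S = "topspace X"
  have sub: "carrier (homeo_group X) \<subseteq> Bij ?S"
    by (auto simp: homeo_group_def Bij_def bij_betw_def
        dest: homeomorphic_imp_injective_map homeomorphic_imp_surjective_map)
  have closed: "compose ?S g f \<in> carrier (homeo_group X)"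
    if "g \<in> carrier (homeo_group X)" "f \<in> carrier (homeo_group X)" for g f
  proof -
    have "homeomorphic_map X X (g \<circ> f)"
      using that by (auto simp: homeo_group_def intro: homeomorphic_map_compose)
    then have "homeomorphic_map X X (compose ?S g f)"
      by (rule homeomorphic_map_eq) (simp add: compose_def)
    then show ?thesis by (simp add: homeo_group_def)
  qed
  have inv: "inv\<^bsub>BijGroup ?S\<^esub> f \<in> carrier (homeo_group X)"
    if f: "f \<in> carrier (homeo_group X)" for f
  proof -
    from f have "homeomorphic_map X X f" by (simp add: homeo_group_def)
    then obtain g where g: "homeomorphic_maps X X f g"
      using homeomorphic_map_maps by blast
    then have "homeomorphic_map X X g"
      using homeomorphic_maps_map by blast
    then have "homeomorphic_map X X (restrict g ?S)"
      by (rule homeomorphic_map_eq) simp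
    then have r: "restrict g ?S \<in> carrier (homeo_group X)"
      by (simp add: homeo_group_def)
    have fS: "f ` ?S \<subseteq> ?S" and gf: "\<And>x. x \<in> ?S \<Longrightarrow> g (f x) = x"
      using g by (auto simp: homeomorphic_maps_def continuous_map_def)
    have "compose ?S (restrict g ?S) f = (\<lambda>x\<in>?S. x)"
      using fS gf by (auto simp: compose_def fun_eq_iff)
    then have "restrict g ?S \<otimes>\<^bsub>BijGroup ?S\<^esub> f = \<one>\<^bsub>BijGroup ?S\<^esub>"
      using sub r f by (auto simp: BijGroup_def)
    then have "inv\<^bsub>BijGroup ?S\<^esub> f = restrict g ?S"
      using sub r f by (intro B.inv_equality) (auto simp: BijGroup_def)
    then show ?thesis using r by simp
  qed
  have one: "(\<lambda>x\<in>?S. x) \<in> carrier (homeo_group X)"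
    using homeomorphic_map_eq[of X X id "\<lambda>x\<in>?S. x"] by (simp add: homeo_group_def)
  show ?thesis
    using sub closed inv one
    by (intro subgroup.intro) (auto simp: BijGroup_def subset_iff)
qed

lemma group_homeo_group: "group (homeo_group X)"
  using subgroup.subgroup_is_group[OF subgroup_homeo_group group_BijGroup, of X]
  by (simp add: homeo_group_def)

lemma homeo_group_euclidean:
  "carrier (homeo_group (euclidean :: 'a::topological_space topology)) =
     {h. homeomorphic_map euclidean euclidean h}"
  "\<one>\<^bsub>homeo_group (euclidean :: 'a topology)\<^esub> = id"
  by (auto simp: homeo_group_def BijGroup_def)

definition rigid_space :: "'a topology \<Rightarrow> bool" where
  "rigid_space X \<longleftrightarrow> carrier (homeo_group X) = {\<one>\<^bsub>homeo_group X\<^esub>}"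

definition saturation :: "('a \<Rightarrow> 'a) set \<Rightarrow> 'a set \<Rightarrow> 'a set" where
  "saturation H X = (\<Union>h\<in>H. h ` X)"

definition point_orbit :: "('a \<Rightarrow> 'a) set \<Rightarrow> 'a \<Rightarrow> 'a set" where
  "point_orbit H x = saturation H {x}"

text \<open>A homeomorphism \<open>g\<close> with domain \<open>A\<close> and range \<open>B\<close> is given as a triple \<open>(A, B, g)\<close>;
  the values of \<open>g\<close> outside \<open>A\<close> are irrelevant.\<close>

definition gdelta_homeos :: "('a::topological_space set \<times> 'a set \<times> ('a \<Rightarrow> 'a)) set" where
  "gdelta_homeos =
     {(A, B, g). gdelta_in euclidean A \<and> gdelta_in euclidean B \<and>
                 homeomorphic_map (top_of_set A) (top_of_set B) g}"


section \<open>Cardinals\<close>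

definition nowhere_dense :: "'a::topological_space set \<Rightarrow> bool" where
  "nowhere_dense A \<longleftrightarrow> interior (closure A) = {}"

definition meager :: "'a::topological_space set \<Rightarrow> bool" where
  "meager M \<longleftrightarrow> (\<exists>F. countable F \<and> (\<forall>A\<in>F. nowhere_dense A) \<and> M = \<Union>F)"

definition meager_family_nonmeager_union :: "cantor set set \<Rightarrow> bool" where
  "meager_family_nonmeager_union F \<longleftrightarrow> (\<forall>M\<in>F. meager M) \<and> \<not> meager (\<Union>F)"

definition add_meager :: "cantor set rel" where
  "add_meager =
     |SOME F. meager_family_nonmeager_union F \<and>
              (\<forall>F'. meager_family_nonmeager_union F' \<longrightarrow> |F| \<le>o |F'| )|"

abbreviation continuum :: "(nat \<Rightarrow> bool) rel" where
  "continuum \<equiv> ctwo ^c natLeq"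

lemma compact_Hausdorff_cantor:
  "compact_space (euclidean :: cantor topology)" "Hausdorff_space (euclidean :: cantor topology)"
  unfolding cantor_topology
  by (simp_all add: compact_space_product_topology compact_space_discrete_topology
      Hausdorff_space_product_topology)

lemma nowhere_dense_singleton: "nowhere_dense {x :: cantor}"
proof -
  have "\<not> openin euclidean {x}"
  proof
    assume "openin euclidean {x}"
    then have "open {x}" by simp
    then have "openin (product_topology (\<lambda>_::nat. euclidean :: bool topology) UNIV) {x}"
      by (simp add: open_fun_def)
    then obtain U where U: "finite {i. U i \<noteq> UNIV}" "x \<in> Pi\<^sub>E UNIV U" "Pi\<^sub>E UNIV U \<subseteq> {x}"
      unfolding openin_product_topology_alt by force
    obtain i where i: "U i = UNIV"
      using U(1) by (metis (mono_tags, lifting) ex_new_if_finite infinite_UNIV_nat mem_Collect_eq)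
    have "x(i := \<not> x i) \<in> Pi\<^sub>E UNIV U"
      using U(2) i by (auto simp: PiE_iff)
    then have "x(i := \<not> x i) = x" using U(3) by blast
    then show False by (metis fun_upd_same)
  qed
  then have "\<not> open {x}" by simp
  moreover have "interior {x} \<subseteq> {x}" by (rule interior_subset)
  ultimately have "interior {x} = {}"
    using open_interior[of "{x}"] by (metis subset_singletonD)
  moreover have "closedin euclidean {x}"
    using closedin_Hausdorff_sing_eq[OF compact_Hausdorff_cantor(2), of x] by simp
  then have "closure {x} = {x}" by simp
  ultimately show ?thesis by (simp add: nowhere_dense_def)
qed

lemma not_meager_UNIV: "\<not> meager (UNIV :: cantor set)"
proof
  assume "meager (UNIV :: cantor set)"
  then obtain F :: "cantor set set"
    where F: "countable F" "\<And>A. A \<in> F \<Longrightarrow> nowhere_dense A" "\<Union>F = UNIV"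
    unfolding meager_def by auto
  have "locally_compact_space (euclidean :: cantor topology) \<and>
        regular_space (euclidean :: cantor topology)"
    using compact_Hausdorff_cantor
    by (auto intro: compact_imp_locally_compact_space compact_Hausdorff_imp_regular_space)
  then have "euclidean interior_of \<Union>(closure ` F) = ({} :: cantor set)"
    using F(1,2) by (intro Baire_category_alt) (auto simp: nowhere_dense_def)
  moreover have "\<Union>(closure ` F) = UNIV"
    using F(3) closure_subset by blast
  ultimately show False by simp
qed

lemma add_meager_attained:
  "\<exists>F. meager_family_nonmeager_union F \<and> add_meager = |F| \<and>
       (\<forall>F'. meager_family_nonmeager_union F' \<longrightarrow> |F| \<le>o |F'| )"
proof -
  let ?R = "card_of ` Collect meager_family_nonmeager_union"
  have "meager_family_nonmeager_union (range (\<lambda>x. {x}))"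
    unfolding meager_family_nonmeager_union_def
  proof (intro conjI ballI)
    fix M :: "cantor set" assume "M \<in> range (\<lambda>x. {x})"
    then have "nowhere_dense M" using nowhere_dense_singleton by auto
    then show "meager M" unfolding meager_def by (intro exI[of _ "{M}"]) auto
  qed (use not_meager_UNIV in simp)
  then have "?R \<noteq> {}" by blast
  moreover have "\<forall>r\<in>?R. Card_order r" by (auto simp: card_of_Card_order)
  ultimately have "\<exists>r\<in>?R. \<forall>r'\<in>?R. r \<le>o r'" by (rule exists_minim_Card_order)
  then have "\<exists>F. meager_family_nonmeager_union F \<and>
               (\<forall>F'. meager_family_nonmeager_union F' \<longrightarrow> |F| \<le>o |F'| )"
    by auto
  from someI_ex[OF this] show ?thesis
    unfolding add_meager_def by blast
qed

end

theory Submission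
  imports Defs
begin

text \<open>
  The complement of \<open>X\<close> is made rigid by splitting every point of \<open>D\<close> in two. There is a
  continuous surjection \<open>p\<close> of the Cantor set onto itself whose fibres have one point outside \<open>D\<close>
  and two points over \<open>D\<close> (lemma \<open>split_points_of_cantor\<close>). Since \<open>X\<close> misses \<open>D\<close>, the map \<open>p\<close>
  restricts to a homeomorphism from \<open>p -` X\<close> onto \<open>X\<close>, and \<open>p -` X\<close> is the required subspace. Its
  complement \<open>W = p -` Y\<close> contains both halves of every split point.

  Let \<open>g\<close> be a self-homeomorphism of \<open>W\<close>. By Lavrentiev's theorem it extends to a homeomorphism
  \<open>G\<close> between two \<open>G\<^sub>\<delta>\<close> sets containing \<open>W\<close>. Away from countably many points \<open>G\<close> avoids the
  split points on both sides, and there it descends through \<open>p\<close> to a homeomorphism \<open>k\<close> between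
  \<open>G\<^sub>\<delta>\<close> subsets of the original Cantor set (lemma \<open>push_down_gdelta_homeo\<close>). As \<open>G\<close> maps \<open>W\<close> onto
  itself, \<open>k\<close> sends no point of \<open>X\<close> outside \<open>X\<close>. So condition (3) supplies a subgroup \<open>S\<close> of size less
  than \<open>add_meager\<close> such that the points which \<open>k\<close> moves out of their \<open>S\<close>-orbit are not
  continuum many. A Baire category argument with fewer than \<open>add_meager\<close> many closed sets
  (lemma \<open>locally_one_of_few_maps\<close>) turns this into: every nonempty open set contains a nonempty
  open set on which \<open>k\<close> agrees with a single element \<open>s\<close> of \<open>S\<close>.

  Such an \<open>s\<close> is the identity. Otherwise take \<open>d \<in> D\<close> in that open set. Both halves of \<open>d\<close>
  are in the domain of \<open>G\<close>, and by continuity \<open>G\<close> sends both into the fibre over \<open>s d\<close>. By (2),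
  \<open>s d\<close> is not in \<open>D\<close>, so that this fibre is a single point, and \<open>G\<close> is not injective: a
  contradiction. Therefore \<open>k\<close> is the identity on a dense set, and so are \<open>G\<close> and \<open>g\<close>.
\<close>

section \<open>Cylinders and closed perfect subsets of the Cantor set\<close>

definition cylinder :: "cantor \<Rightarrow> nat \<Rightarrow> cantor set" where
  "cylinder x n = {y. \<forall>i<n. y i = x i}"

lemma in_cylinder_self [simp]: "x \<in> cylinder x n"
  by (simp add: cylinder_def)

lemma open_cylinder [simp]: "open (cylinder x n)"
proof -
  have "open {f. \<forall>i\<in>{..<n}. f (id i) \<in> {x i}}"
    by (rule product_topology_basis') (auto simp: open_discrete)
  then show ?thesis by (simp add: cylinder_def lessThan_def)
qed

lemma open_cantor_iff:
  "open (U :: cantor set) \<longleftrightarrow> (\<forall>x\<in>U. \<exists>n. cylinder x n \<subseteq> U)"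
proof (intro iffI ballI)
  fix x assume "open U" "x \<in> U"
  then have "openin (product_topology (\<lambda>_::nat. euclidean :: bool topology) UNIV) U"
    by (simp add: open_fun_def)
  then obtain V where V: "finite {i. V i \<noteq> UNIV}" "x \<in> Pi\<^sub>E UNIV V" "Pi\<^sub>E UNIV V \<subseteq> U"
    using \<open>x \<in> U\<close> unfolding openin_product_topology_alt by force
  obtain n where n: "\<And>i. V i \<noteq> UNIV \<Longrightarrow> i < n"
    using V(1) finite_nat_set_iff_bounded by auto
  have "y \<in> Pi\<^sub>E UNIV V" if "y \<in> cylinder x n" for y
  proof -
    have "y i \<in> V i" for i
    proof (cases "i < n")
      case True
      then have "y i = x i" using that by (simp add: cylinder_def)
      then show ?thesis using V(2) by (auto simp: PiE_iff)
    qed (use n in blast)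
    then show ?thesis by (simp add: PiE_iff)
  qed
  then show "\<exists>n. cylinder x n \<subseteq> U" using V(3) by blast
next
  assume "\<forall>x\<in>U. \<exists>n. cylinder x n \<subseteq> U"
  then show "open U"
    by (meson Topological_Spaces.openI open_cylinder in_cylinder_self)
qed

lemma first_difference:
  fixes x y :: cantor
  assumes "x \<noteq> y"
  obtains m where "y m \<noteq> x m" "y \<in> cylinder x m"
proof -
  have "\<exists>m. y m \<noteq> x m" using assms by (auto simp: fun_eq_iff)
  then have "y (LEAST m. y m \<noteq> x m) \<noteq> x (LEAST m. y m \<noteq> x m)" by (rule LeastI_ex)
  moreover have "y \<in> cylinder x (LEAST m. y m \<noteq> x m)"
    unfolding cylinder_def
  proof (intro CollectI allI impI)
    fix i assume "i < (LEAST m. y m \<noteq> x m)"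
    from not_less_Least[OF this] show "y i = x i" by simp
  qed
  ultimately show ?thesis by (rule that)
qed

lemma locally_constant_imp_continuous_on:
  fixes f :: "cantor \<Rightarrow> 'a::topological_space"
  assumes "\<And>x. x \<in> S \<Longrightarrow> \<exists>n. \<forall>y\<in>S \<inter> cylinder x n. f y = f x"
  shows "continuous_on S f"
  unfolding continuous_on_topological
proof (intro ballI allI impI)
  fix x V assume x: "x \<in> S" "open V" "f x \<in> V"
  from assms[OF x(1)] obtain n where n: "\<forall>y\<in>S \<inter> cylinder x n. f y = f x" ..
  show "\<exists>U. open U \<and> x \<in> U \<and> (\<forall>y\<in>S. y \<in> U \<longrightarrow> f y \<in> V)"
  proof (intro exI[of _ "cylinder x n"] conjI ballI impI)
    fix y assume "y \<in> S" "y \<in> cylinder x n"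
    then have "f y = f x" by (intro bspec[OF n] IntI)
    then show "f y \<in> V" using x(3) by (rule ssubst)
  qed (rule open_cylinder in_cylinder_self)+
qed

lemma closed_imp_compact_space_cantor:
  "closed (Z :: cantor set) \<Longrightarrow> compact_space (top_of_set Z)"
  using closedin_compact_space[OF compact_Hausdorff_cantor(1), of Z]
  by (simp add: compact_space_subtopology)

text \<open>The beginning of the increasing enumeration of a set does not see the rest of the set.\<close>

lemma enumerate_cong_upto:
  fixes B C :: "nat set"
  assumes "infinite B" "infinite C" and eq: "\<And>i. i \<le> m \<Longrightarrow> i \<in> B \<longleftrightarrow> i \<in> C"
    and "enumerate B n \<le> m"
  shows "enumerate C n = enumerate B n"
  using assms(4)
proof (induction n)
  case 0
  have e: "enumerate B 0 = (LEAST i. i \<in> B)" by (simp add: enumerate_0)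
  have "(LEAST i. i \<in> C) = enumerate B 0"
  proof (rule Least_equality)
    show "enumerate B 0 \<in> C"
      using enumerate_in_set[OF assms(1), of 0] eq 0 by blast
    fix y assume y: "y \<in> C"
    show "enumerate B 0 \<le> y"
    proof (cases "y \<le> m")
      case True
      then have "y \<in> B" using y eq by blast
      then show ?thesis unfolding e by (rule Least_le)
    qed (use 0 in auto)
  qed
  then show ?case by (simp add: enumerate_0)
next
  case (Suc n)
  have lt: "enumerate B n < enumerate B (Suc n)" using assms(1) by (simp add: enumerate_step)
  then have IH: "enumerate C n = enumerate B n" using Suc by simp
  have e: "enumerate B (Suc n) = (LEAST i. i \<in> B \<and> enumerate B n < i)" 
    using assms(1) by (simp add: enumerate_Suc'')
  have "(LEAST i. i \<in> C \<and> enumerate C n < i) = enumerate B (Suc n)"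
  proof (rule Least_equality)
    show "enumerate B (Suc n) \<in> C \<and> enumerate C n < enumerate B (Suc n)"
      using enumerate_in_set[OF assms(1), of "Suc n"] eq Suc.prems IH lt by auto
    fix y assume y: "y \<in> C \<and> enumerate C n < y"
    show "enumerate B (Suc n) \<le> y"
    proof (cases "y \<le> m")
      case True
      then have "y \<in> B \<and> enumerate B n < y" using y eq IH by auto
      then show ?thesis unfolding e by (rule Least_le)
    qed (use Suc.prems in auto)
  qed
  then show ?case using assms(2) by (simp add: enumerate_Suc'')
qed

text \<open>The tree of initial segments of members of \<open>Z\<close> branches above every node, so contracting
  its non-branching nodes gives the full binary tree. Concretely, \<open>x \<in> Z\<close> is sent to the sequence of
  its values at its branching levels \<open>B x\<close> only.\<close>

lemma perfect_closed_homeomorphic_cantor: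
  fixes Z :: "cantor set"
  assumes "closed Z" "Z \<noteq> {}"
    and perfect: "\<And>x n. x \<in> Z \<Longrightarrow> \<exists>y\<in>Z \<inter> cylinder x n. y \<noteq> x"
  obtains f where "homeomorphic_map (top_of_set Z) (euclidean :: cantor topology) f"
proof -
  define B where "B x = {m. \<exists>y\<in>Z \<inter> cylinder x m. y m \<noteq> x m}" for x
  define F where "F x n = x (enumerate (B x) n)" for x n
  have inf: "infinite (B x)" if x: "x \<in> Z" for x
    unfolding infinite_nat_iff_unbounded_le
  proof
    fix n
    obtain y where y: "y \<in> Z \<inter> cylinder x n" "y \<noteq> x" using perfect x by blast
    obtain m where ym: "y m \<noteq> x m" "y \<in> cylinder x m"
      using first_difference[of x y] y(2) by blast
    then have "m \<in> B x" using y ym by (auto simp: B_def)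
    moreover have "n \<le> m" using y(1) ym(1) by (force simp: cylinder_def not_less)
    ultimately show "\<exists>m\<ge>n. m \<in> B x" by blast
  qed
  \<comment> \<open>Whether level \<open>i\<close> is branching for \<open>x\<close> is decided by the values of \<open>x\<close> below \<open>i\<close>.\<close>
  have B_cong: "i \<in> B x \<longleftrightarrow> i \<in> B y"
    if "x \<in> Z" "y \<in> Z" "y \<in> cylinder x m" "i \<le> m" for x y m i
  proof -
    have "i \<in> B y" if "x \<in> Z" "y \<in> Z" "y \<in> cylinder x m" "i \<le> m" "i \<in> B x" for x y
    proof (cases "y i = x i")
      case True
      then show ?thesis using that by (fastforce simp: B_def cylinder_def)
    next
      case False
      then have "x \<in> Z \<inter> cylinder y i" "x i \<noteq> y i"
        using that by (auto simp: cylinder_def)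
      then show ?thesis by (auto simp: B_def)
    qed
    moreover have "x \<in> cylinder y m" using that by (simp add: cylinder_def)
    ultimately show ?thesis using that by blast
  qed
  have enum: "enumerate (B y) n = enumerate (B x) n"
    if "x \<in> Z" "y \<in> Z" "y \<in> cylinder x (enumerate (B x) n)" for x y n
  proof (rule enumerate_cong_upto)
    show "infinite (B x)" "infinite (B y)" using inf that by blast+
    show "i \<in> B x \<longleftrightarrow> i \<in> B y" if "i \<le> enumerate (B x) n" for i
      by (rule B_cong[OF \<open>x \<in> Z\<close> \<open>y \<in> Z\<close> \<open>y \<in> cylinder x (enumerate (B x) n)\<close> that])
  qed simp
  have cont: "continuous_on Z F"
  proof (intro continuous_on_coordinatewise_then_product locally_constant_imp_continuous_on exI ballI)
    fix n x y assume *: "x \<in> Z" "y \<in> Z \<inter> cylinder x (Suc (enumerate (B x) n))"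
    then have "enumerate (B y) n = enumerate (B x) n"
      by (intro enum) (auto simp: cylinder_def)
    then show "F y n = F x n" using * by (simp add: F_def cylinder_def)
  qed
  have inj: "inj_on F Z"
  proof (rule inj_onI, rule ccontr)
    fix x y assume *: "x \<in> Z" "y \<in> Z" "F x = F y" "x \<noteq> y"
    obtain m where ym: "y m \<noteq> x m" and cyl: "y \<in> cylinder x m"
      using first_difference[of x y] *(4) by blast
    then have "m \<in> B x" using * by (auto simp: B_def)
    then obtain n where n: "enumerate (B x) n = m" using enumerate_Ex inf *(1) by blast
    then have "enumerate (B y) n = m" using enum[of x y n] * cyl by simp
    then show False using n fun_cong[OF *(3), of n] ym by (simp add: F_def)
  qed
  \<comment> \<open>A value at a branching level can be flipped without touching the earlier ones, so any finite
    pattern is attained. Surjectivity follows by compactness.\<close>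
  have dense: "\<exists>z\<in>Z. F z \<in> cylinder y n" for y n
  proof (induction n)
    case 0
    then show ?case using assms(2) by (auto simp: cylinder_def)
  next
    case (Suc n)
    then obtain z where z: "z \<in> Z" "F z \<in> cylinder y n" by blast
    show ?case
    proof (cases "F z n = y n")
      case True
      then have "F z \<in> cylinder y (Suc n)" using z by (simp add: cylinder_def less_Suc_eq)
      then show ?thesis using z by blast
    next
      case False
      have "enumerate (B z) n \<in> B z" using inf z enumerate_in_set by blast
      then obtain w where w: "w \<in> Z" "w \<in> cylinder z (enumerate (B z) n)"
          "w (enumerate (B z) n) \<noteq> z (enumerate (B z) n)"
        by (auto simp: B_def)
      have e: "enumerate (B w) k = enumerate (B z) k" if "k \<le> n" for k
      proof (rule enum)
        have "enumerate (B z) k \<le> enumerate (B z) n"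
          using inf[OF z(1)] that by (simp add: enumerate_mono_le_iff)
        then show "w \<in> cylinder z (enumerate (B z) k)"
          using w by (auto simp: cylinder_def)
      qed (use z w in auto)
      have "F w k = y k" if "k < n" for k
      proof -
        have "enumerate (B z) k < enumerate (B z) n"
          using inf[OF z(1)] that by (simp add: enumerate_mono)
        then have "F w k = F z k" using e[of k] that w by (simp add: F_def cylinder_def)
        then show ?thesis using z that by (simp add: cylinder_def)
      qed
      moreover have "F w n = y n" using e[of n] w(3) False by (auto simp: F_def)
      ultimately have "F w \<in> cylinder y (Suc n)" by (simp add: cylinder_def less_Suc_eq)
      then show ?thesis using w by blast
    qed
  qed
  have surj: "F ` Z = UNIV"
  proof -
    have cm: "continuous_map (top_of_set Z) euclidean F" using cont by simp
    have "compactin euclidean (F ` Z)"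
      using image_compactin[OF _ cm, of Z] closed_imp_compact_space_cantor[OF assms(1)]
      by (simp add: compact_space_def)
    then have "closed (F ` Z)"
      using compactin_imp_closedin[OF compact_Hausdorff_cantor(2)] by simp
    then have o: "open (- F ` Z)" by (simp add: closed_def)
    show ?thesis
    proof (rule ccontr)
      assume "F ` Z \<noteq> UNIV"
      then obtain y where "y \<in> - F ` Z" by blast
      then obtain n where "cylinder y n \<subseteq> - F ` Z" using o open_cantor_iff by blast
      then show False using dense[of y n] by blast
    qed
  qed
  show ?thesis
  proof
    show "homeomorphic_map (top_of_set Z) (euclidean :: cantor topology) F"
      using cont inj surj closed_imp_compact_space_cantor[OF assms(1)] compact_Hausdorff_cantor(2)
      by (intro continuous_imp_homeomorphic_map) auto
  qed
qed

section \<open>Splitting countably many points\<close>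

text \<open>The parity of the first difference from \<open>y\<close> divides the complement of \<open>{y}\<close> into two open
  sets, each having \<open>y\<close> in its closure. This is how a point is split.\<close>

definition difference_parity :: "cantor \<Rightarrow> cantor \<Rightarrow> bool" where
  "difference_parity x y = even (LEAST i. x i \<noteq> y i)"

lemma difference_parity_cong:
  assumes "x i \<noteq> y i" "x' \<in> cylinder x (Suc i)"
  shows "difference_parity x' y = difference_parity x y" "x' \<noteq> y"
proof -
  define l where "l = (LEAST i. x i \<noteq> y i)"
  have "x l \<noteq> y l" unfolding l_def using assms(1) by (rule LeastI)
  moreover have "l \<le> i" unfolding l_def using assms(1) by (rule Least_le)
  moreover have "x j = y j" if "j < l" for j
    using not_less_Least[of j "\<lambda>i. x i \<noteq> y i"] that by (simp add: l_def)
  ultimately have l: "x l \<noteq> y l" "l \<le> i" "\<And>j. j < l \<Longrightarrow> x j = y j" by blast+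
  have "(LEAST j. x' j \<noteq> y j) = l"
  proof (rule Least_equality)
    show "x' l \<noteq> y l" using l assms(2) by (simp add: cylinder_def)
    fix j assume "x' j \<noteq> y j"
    then have "\<not> j < l" using l assms(2) by (auto simp: cylinder_def)
    then show "l \<le> j" by simp
  qed
  then show "difference_parity x' y = difference_parity x y"
    by (simp add: difference_parity_def l_def)
  show "x' \<noteq> y" using assms by (auto simp: cylinder_def)
qed

text \<open>To a point \<open>x\<close> add, for each \<open>n\<close>, one bit recording on which side of \<open>d n\<close> it lies; if
  \<open>x = d n\<close>, then both values of that bit are limits of the bits of nearby points. The extended
  points form a closed set without isolated points, hence a copy of the Cantor set, and \<open>p\<close> forgets
  the extra bits.\<close>

lemma split_points_of_cantor:
  fixes d :: "nat \<Rightarrow> cantor"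
  obtains p :: "cantor \<Rightarrow> cantor" where "continuous_on UNIV p"
    "\<And>x. x \<notin> range d \<Longrightarrow> \<exists>z. p -` {x} = {z}"
    "\<And>x. x \<in> range d \<Longrightarrow> \<exists>z w. z \<noteq> w \<and> p -` {x} = {z, w}"
proof -
  \<comment> \<open>Even positions carry \<open>x\<close>, position \<open>2 * n + 1\<close> carries the bit for \<open>d n\<close>. The parameter \<open>b\<close> is the
    free choice at a point of the sequence; all indices of a repeated point get the same bit.\<close>
  define pt where "pt b x k =
      (if even k then x (k div 2)
       else if d (k div 2) = x then b else difference_parity x (d (k div 2)))" for b x k
  define q where "q z n = z (2 * n)" for z :: cantor and n
  have q_pt [simp]: "q (pt b x) = x" for b x by (auto simp: q_def pt_def)
  have pt_odd: "pt b x (Suc (2 * n)) = (if d n = x then b else difference_parity x (d n))" for b x n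
    by (simp add: pt_def)
  define Z where "Z = {pt b x |b x. True}"
  have cont_q: "continuous_on S q" for S
  proof (intro continuous_on_coordinatewise_then_product locally_constant_imp_continuous_on exI ballI)
    fix n x y assume "y \<in> S \<inter> cylinder x (Suc (2 * n))"
    then show "q y n = q x n" by (simp add: q_def cylinder_def)
  qed
  have q_cyl: "q w \<in> cylinder (q z) n" if "w \<in> cylinder z m" "2 * n \<le> m" for w z n m
    using that by (auto simp: q_def cylinder_def)
  have "closed Z"
    unfolding closed_def open_cantor_iff
  proof (rule ballI, rule ccontr)
    fix z assume z: "z \<in> - Z" and "\<not> (\<exists>n. cylinder z n \<subseteq> - Z)"
    then have "\<exists>w\<in>Z. w \<in> cylinder z n" for n by blast
    then have approx: "\<exists>b x. pt b x \<in> cylinder z n" for n unfolding Z_def by blast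
    define x where "x = q z"
    \<comment> \<open>Each equation that singles out the members of \<open>Z\<close> involves finitely many coordinates, so
      it passes from members of \<open>Z\<close> arbitrarily close to \<open>z\<close> on to \<open>z\<close>.\<close>
    have off: "z (Suc (2 * n)) = difference_parity x (d n)" if "d n \<noteq> x" for n
    proof -
      obtain i where i: "x i \<noteq> d n i" using \<open>d n \<noteq> x\<close> by (auto simp: fun_eq_iff)
      obtain b x' where *: "pt b x' \<in> cylinder z (2 * Suc i + 2 * n + 2)" using approx by blast
      then have "x' \<in> cylinder x (Suc i)" using q_cyl[OF *, of "Suc i"] by (simp add: x_def)
      note P = difference_parity_cong[where y = "d n", OF i this]
      have "z (Suc (2 * n)) = pt b x' (Suc (2 * n))" using * by (simp add: cylinder_def)
      then show ?thesis using P by (simp add: pt_odd)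
    qed
    have on: "z (Suc (2 * n)) = z (Suc (2 * m))" if "d n = d m" for n m
    proof -
      obtain b x' where *: "pt b x' \<in> cylinder z (2 * n + 2 * m + 2)" using approx by blast
      then have "z (Suc (2 * n)) = pt b x' (Suc (2 * n))" "z (Suc (2 * m)) = pt b x' (Suc (2 * m))"
        by (simp_all add: cylinder_def)
      then show ?thesis using that by (simp add: pt_odd)
    qed
    define b where "b = z (Suc (2 * (SOME n. d n = x)))"
    have "z k = pt b x k" for k
    proof (cases "even k")
      case True
      then show ?thesis by (auto simp: pt_def x_def q_def)
    next
      case False
      then obtain n where k: "k = Suc (2 * n)" by (auto elim: oddE)
      show ?thesis
      proof (cases "d n = x")
        case True
        then have "d (SOME n. d n = x) = d n" using someI[of "\<lambda>n. d n = x" n] by simp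
        then show ?thesis using on True by (simp add: k pt_odd b_def)
      qed (simp add: k pt_odd off)
    qed
    then have "z = pt b x" by (rule ext)
    then have "z \<in> Z" unfolding Z_def by blast
    then show False using z by blast
  qed
  moreover have "Z \<noteq> {}" by (auto simp: Z_def)
  moreover have "\<exists>w\<in>Z \<inter> cylinder z N. w \<noteq> z" if zZ: "z \<in> Z" for z N
  proof -
    obtain b x where z: "z = pt b x" using zZ by (auto simp: Z_def)
    have "\<forall>n. \<exists>i. d n \<noteq> x \<longrightarrow> x i \<noteq> d n i" by (auto simp: fun_eq_iff)
    then obtain \<delta> where \<delta>: "\<And>n. d n \<noteq> x \<Longrightarrow> x (\<delta> n) \<noteq> d n (\<delta> n)" by metis
    \<comment> \<open>Beyond \<open>k\<close> a change of \<open>x\<close> affects no bit for a \<open>d n \<noteq> x\<close> with \<open>n < N\<close>. Flipping \<open>x\<close> at a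
      position \<open>j\<close> of the right parity also keeps the bit \<open>b\<close> for each \<open>d n = x\<close>.\<close>
    define k where "k = N + (\<Sum>n<N. Suc (\<delta> n))"
    have k: "\<delta> n < k" if "n < N" for n
      using member_le_sum[of n "{..<N}" "\<lambda>n. Suc (\<delta> n)"] that by (simp add: k_def)
    define j where "j = (if even k = b then k else Suc k)"
    have j: "k \<le> j" "even j = b" by (auto simp: j_def)
    define x' where "x' = x(j := \<not> x j)"
    have "pt b x' i = z i" if i: "i < N" for i
    proof (cases "even i")
      case True
      then show ?thesis using i j by (auto simp: z pt_def x'_def k_def)
    next
      case False
      then obtain n where n: "i = Suc (2 * n)" by (auto elim: oddE)
      show ?thesis
      proof (cases "d n = x")
        case True
        have "x' \<noteq> x" by (metis fun_upd_same x'_def)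
        moreover have "(LEAST i. x' i \<noteq> x i) = j" by (auto simp: x'_def intro!: Least_equality)
        ultimately show ?thesis using True j by (auto simp: n z pt_odd difference_parity_def)
      next
        case False
        have "x' \<in> cylinder x (Suc (\<delta> n))" using k[of n] n i j by (auto simp: cylinder_def x'_def)
        from difference_parity_cong[where y = "d n", OF \<delta>[OF False] this] show ?thesis
          using False by (auto simp: n z pt_odd)
      qed
    qed
    then have "pt b x' \<in> Z \<inter> cylinder z N" by (auto simp: Z_def cylinder_def)
    moreover have "x' j \<noteq> x j" by (simp add: x'_def)
    then have "q (pt b x') \<noteq> q z" by (metis q_pt z)
    then have "pt b x' \<noteq> z" by blast
    ultimately show ?thesis by blast
  qed
  ultimately obtain f where "homeomorphic_map (top_of_set Z) (euclidean :: cantor topology) f"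
    using perfect_closed_homeomorphic_cantor by metis
  then obtain h where h: "homeomorphic_maps (top_of_set Z) (euclidean :: cantor topology) f h"
    using homeomorphic_map_maps by blast
  then have cont_h: "continuous_on UNIV h" and hZ: "\<And>y. h y \<in> Z" and fh: "\<And>y. f (h y) = y"
    and hf: "\<And>z. z \<in> Z \<Longrightarrow> h (f z) = z"
    by (auto simp: homeomorphic_maps_def continuous_map_in_subtopology)
  have fibre: "(q \<circ> h) -` {x} = {f (pt True x), f (pt False x)}" (is "?l = ?r") for x
  proof
    show "?l \<subseteq> ?r"
    proof
      fix y assume "y \<in> ?l"
      moreover obtain b x' where hy: "h y = pt b x'" using hZ[of y] by (auto simp: Z_def)
      ultimately have "h y = pt b x" by simp
      then show "y \<in> ?r" using fh[of y] by (cases b) auto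
    qed
    have "pt b x \<in> Z" for b by (auto simp: Z_def)
    then show "?r \<subseteq> ?l" using hf by auto
  qed
  show ?thesis
  proof
    show "continuous_on UNIV (q \<circ> h)"
      using cont_h cont_q by (intro continuous_on_compose)
    fix x
    {
      assume "x \<notin> range d"
      then have "d n \<noteq> x" for n by blast
      then have "pt True x = pt False x" by (intro ext) (simp add: pt_def)
      then show "\<exists>z. (q \<circ> h) -` {x} = {z}" using fibre[of x] by auto
    next
      assume "x \<in> range d"
      then obtain n where "d n = x" by blast
      then have "pt True x (Suc (2 * n)) \<noteq> pt False x (Suc (2 * n))" by (simp add: pt_odd)
      then have "pt True x \<noteq> pt False x" by metis
      moreover have "pt b x \<in> Z" for b by (auto simp: Z_def)
      ultimately have "f (pt True x) \<noteq> f (pt False x)" by (metis hf)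
      then show "\<exists>z w. z \<noteq> w \<and> (q \<circ> h) -` {x} = {z, w}" using fibre[of x] by blast
    }
  qed
qed

section \<open>Baire category in the Cantor set\<close>

lemma completely_metrizable_cantor: "completely_metrizable_space (euclidean :: cantor topology)"
  unfolding cantor_topology completely_metrizable_space_product_topology
  by (simp add: completely_metrizable_space_discrete_topology)

lemma closed_singleton_cantor: "closed {x :: cantor}"
  using closedin_Hausdorff_sing_eq[OF compact_Hausdorff_cantor(2), of x] by simp

lemma meager_Un:
  assumes "meager M" "meager N"
  shows "meager (M \<union> N)"
proof -
  obtain F G where "countable F" "\<forall>A\<in>F. nowhere_dense A" "M = \<Union>F"
    "countable G" "\<forall>A\<in>G. nowhere_dense A" "N = \<Union>G"
    using assms unfolding meager_def by blast
  then show ?thesis unfolding meager_def by (intro exI[of _ "F \<union> G"]) auto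
qed

lemma nowhere_dense_imp_meager: "nowhere_dense A \<Longrightarrow> meager A"
  unfolding meager_def by (intro exI[of _ "{A}"]) auto

lemma countable_imp_meager:
  "countable (C :: cantor set) \<Longrightarrow> meager C"
  unfolding meager_def using nowhere_dense_singleton
  by (intro exI[of _ "(\<lambda>x. {x}) ` C"]) auto

lemma open_subset_meager_imp_empty:
  fixes U :: "cantor set"
  assumes "meager M" "open U" "U \<subseteq> M"
  shows "U = {}"
proof -
  obtain F :: "cantor set set"
    where F: "countable F" "\<And>A. A \<in> F \<Longrightarrow> nowhere_dense A" "M = \<Union>F"
    using assms(1) unfolding meager_def by auto
  have "euclidean interior_of \<Union>(closure ` F) = ({} :: cantor set)"
    using F(1,2) completely_metrizable_cantor
    by (intro Baire_category_alt) (auto simp: nowhere_dense_def)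
  moreover have "U \<subseteq> \<Union>(closure ` F)"
    using F(3) assms(3) closure_subset by blast
  ultimately show ?thesis using assms(2)
    by (metis interior_of_maximal open_openin subset_empty)
qed

lemma dense_gdelta_imp_comeager:
  fixes A :: "cantor set"
  assumes "gdelta_in euclidean A" "closure A = UNIV"
  shows "meager (- A)"
proof -
  obtain C where C: "\<And>n::nat. open (C n)" "\<Inter>(range C) = A"
    using assms(1) unfolding gdelta_in_descending by auto
  have "nowhere_dense (- C n)" for n
  proof -
    have "A \<subseteq> C n" using C by blast
    then have "closure (C n) = UNIV" using assms(2) closure_mono by blast
    then show ?thesis using C(1)
      by (simp add: nowhere_dense_def interior_complement closed_def closure_closed)
  qed
  then show ?thesis unfolding meager_def using C
    by (intro exI[of _ "range (\<lambda>n. - C n)"]) auto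
qed

lemma meager_Union_less_add_meager:
  fixes F :: "cantor set set"
  assumes "\<And>M. M \<in> F \<Longrightarrow> meager M" "|F| <o add_meager"
  shows "meager (\<Union>F)"
proof (rule ccontr)
  assume "\<not> meager (\<Union>F)"
  then have "meager_family_nonmeager_union F"
    using assms(1) by (simp add: meager_family_nonmeager_union_def)
  then have "add_meager \<le>o |F|" using add_meager_attained by metis
  then show False using assms(2) by (metis not_ordLess_ordLeq)
qed

text \<open>Removing the closures of the nowhere dense pieces leaves a \<open>G\<^sub>\<delta>\<close> set, completely metrizable and
  without isolated points because one further point is again meager. Perfect sets in such spaces
  have at least the size of the continuum.\<close>

lemma cantor_lepoll_open_minus_meager:
  fixes U :: "cantor set"
  assumes "open U" "U \<noteq> {}" "meager M"
  shows "(UNIV :: cantor set) \<lesssim> U - M"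
proof -
  obtain F :: "cantor set set"
    where F: "countable F" "\<And>A. A \<in> F \<Longrightarrow> nowhere_dense A" "M = \<Union>F"
    using assms(3) unfolding meager_def by auto
  define N where "N = \<Union>(closure ` F)"
  have "meager N"
    unfolding meager_def N_def using F by (intro exI[of _ "closure ` F"]) (auto simp: nowhere_dense_def)
  have "fsigma_in euclidean N"
    unfolding N_def using F(1) by (intro fsigma_in_Union) (auto intro: closed_imp_fsigma_in)
  then have gd: "gdelta_in euclidean (U - N)"
    using assms(1) by (intro gdelta_in_diff open_imp_gdelta_in) auto
  let ?X = "top_of_set (U - N)"
  have "?X derived_set_of (U - N) = U - N"
  proof
    show "?X derived_set_of (U - N) \<subseteq> U - N"
      using derived_set_of_subset_topspace[of ?X "U - N"] by simp
    show "U - N \<subseteq> ?X derived_set_of (U - N)"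
    proof
      fix x assume x: "x \<in> U - N"
      have "\<exists>y\<noteq>x. y \<in> U - N \<and> y \<in> T" if T: "x \<in> T" "openin ?X T" for T
      proof -
        obtain V where V: "open V" "T = (U - N) \<inter> V" using T(2) by (auto simp: openin_open)
        have m: "meager (N \<union> {x})"
          by (intro meager_Un \<open>meager N\<close> nowhere_dense_imp_meager nowhere_dense_singleton)
        have "\<not> U \<inter> V \<subseteq> N \<union> {x}"
          using open_subset_meager_imp_empty[OF m, of "U \<inter> V"] V T x assms(1) by auto
        then show ?thesis using V by blast
      qed
      then show "x \<in> ?X derived_set_of (U - N)" using x by (auto simp: in_derived_set_of)
    qed
  qed
  moreover have "U - N \<noteq> {}"
    using open_subset_meager_imp_empty[OF \<open>meager N\<close> assms(1)] assms(2) by blast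
  moreover have "completely_metrizable_space ?X"
    using gd completely_metrizable_cantor completely_metrizable_space_gdelta_in by blast
  ultimately have "(UNIV :: real set) \<lesssim> U - N"
    using lepoll_perfect_set by blast
  moreover have "(UNIV :: cantor set) \<lesssim> (UNIV :: nat set set)"
    unfolding lepoll_def
    by (intro exI[of _ "\<lambda>f. {n. f n}"]) (auto simp: inj_on_def fun_eq_iff)
  moreover have "(UNIV :: nat set set) \<lesssim> (UNIV :: real set)"
    using nat_sets_eqpoll_reals eqpoll_imp_lepoll by blast
  moreover have "U - N \<lesssim> U - M"
    by (rule subset_imp_lepoll) (use F(3) closure_subset in \<open>auto simp: N_def\<close>)
  ultimately show ?thesis by (meson lepoll_trans)
qed

lemma continuum_eq_card_cantor: "continuum = |UNIV :: cantor set|"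
  by (simp add: cexp_def ctwo_def Func_def Field_card_of Field_natLeq)

text \<open>If the conclusion fails in \<open>U\<close>, then each coincidence set \<open>C s\<close>, being relatively closed, is nowhere
  dense. Fewer than \<open>add_meager\<close> many of them have a meager union, which leaves continuum many points of
  \<open>U \<inter> A\<close> where \<open>g\<close> differs from every \<open>s\<close>.\<close>

lemma locally_one_of_few_maps:
  fixes A U :: "cantor set" and g :: "cantor \<Rightarrow> cantor"
  assumes A: "gdelta_in euclidean A" "closure A = UNIV"
    and g: "continuous_on A g"
    and S: "\<And>s. s \<in> S \<Longrightarrow> continuous_on UNIV s" "|S| <o add_meager"
    and few: "\<not> |{x \<in> A. \<forall>s\<in>S. g x \<noteq> s x}| =o continuum"
    and U: "open U" "U \<noteq> {}"
  shows "\<exists>V s. open V \<and> V \<noteq> {} \<and> V \<subseteq> U \<and> s \<in> S \<and> (\<forall>x\<in>V \<inter> A. g x = s x)"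
proof (rule ccontr)
  assume none: "\<not> ?thesis"
  then have nowhere: "\<not> (\<forall>x\<in>V \<inter> A. g x = s x)"
    if "open V" "V \<noteq> {}" "V \<subseteq> U" "s \<in> S" for V s
    using none that by blast
  define C where "C s = {x \<in> U \<inter> A. g x = s x}" for s
  have "meager (C s)" if s: "s \<in> S" for s
  proof (rule nowhere_dense_imp_meager, unfold nowhere_dense_def, rule ccontr)
    let ?W = "interior (closure (C s))"
    assume "?W \<noteq> {}"
    then obtain x where x: "x \<in> C s" "x \<in> ?W"
      using open_Int_closure_eq_empty[of ?W "C s"] interior_subset by fastforce
    have "closedin (top_of_set A) {x \<in> topspace (top_of_set A). g x = s x}"
      using g continuous_on_subset[OF S(1)[OF s] subset_UNIV] compact_Hausdorff_cantor(2)
      by (intro closedin_continuous_maps_eq) auto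
    then obtain K where K: "closed K" "{x \<in> A. g x = s x} = A \<inter> K"
      by (auto simp: closedin_closed)
    then have "C s \<subseteq> K" by (auto simp: C_def)
    then have "closure (C s) \<subseteq> K" using K(1) by (rule closure_minimal)
    then have "\<forall>y\<in>(?W \<inter> U) \<inter> A. g y = s y"
      using K(2) interior_subset by fastforce
    moreover have "x \<in> ?W \<inter> U" using x by (simp add: C_def)
    ultimately show False using nowhere[of "?W \<inter> U" s] U(1) s by blast
  qed
  moreover have "|C ` S| <o add_meager"
    using card_of_image S(2) ordLeq_ordLess_trans by blast
  ultimately have "meager (\<Union>(C ` S))" by (intro meager_Union_less_add_meager) auto
  then have "meager (\<Union>(C ` S) \<union> - A)"
    using dense_gdelta_imp_comeager[OF A] by (rule meager_Un)
  then have "(UNIV :: cantor set) \<lesssim> U - (\<Union>(C ` S) \<union> - A)"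
    by (rule cantor_lepoll_open_minus_meager[OF U])
  moreover have "U - (\<Union>(C ` S) \<union> - A) \<subseteq> {x \<in> A. \<forall>s\<in>S. g x \<noteq> s x}"
    by (auto simp: C_def)
  ultimately have "(UNIV :: cantor set) \<lesssim> {x \<in> A. \<forall>s\<in>S. g x \<noteq> s x}"
    by (rule lepoll_trans[OF _ subset_imp_lepoll])
  then have "|UNIV :: cantor set| \<le>o |{x \<in> A. \<forall>s\<in>S. g x \<noteq> s x}|"
    by (auto simp: lepoll_def card_of_ordLeq[symmetric])
  moreover have "|{x \<in> A. \<forall>s\<in>S. g x \<noteq> s x}| \<le>o |UNIV :: cantor set|"
    by (rule card_of_mono1[OF subset_UNIV])
  ultimately have "|{x \<in> A. \<forall>s\<in>S. g x \<noteq> s x}| =o continuum"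
    unfolding continuum_eq_card_cantor by (simp add: ordIso_iff_ordLeq)
  then show False using few by blast
qed

section \<open>Extending homeomorphisms to \<open>G\<^sub>\<delta>\<close> sets\<close>

lemma gdelta_in_preimage:
  assumes "continuous_map X Y f" "gdelta_in Y T"
  shows "gdelta_in X {x \<in> topspace X. f x \<in> T}"
proof -
  obtain C where C: "\<And>n::nat. openin Y (C n)" "\<Inter>(range C) = T"
    using assms(2) unfolding gdelta_in_descending by auto
  have "{x \<in> topspace X. f x \<in> T} = (\<Inter>n. {x \<in> topspace X. f x \<in> C n})" using C(2) by auto
  also have "gdelta_in X \<dots>"
    using C(1) assms(1)
    by (intro gdelta_in_Inter) (auto intro!: open_imp_gdelta_in openin_continuous_map_preimage)
  finally show ?thesis .
qed

text \<open>Extend \<open>f\<close> and its inverse to \<open>G\<^sub>\<delta>\<close> sets inside the closures of \<open>S\<close> and \<open>T\<close>, and keep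
  the points which the first extension sends into the domain of the second. There the composition is the identity, because
  it is so on the dense subset \<open>S\<close>. The image is \<open>G\<^sub>\<delta>\<close> because complete metrizability is a topological
  property.\<close>

lemma Lavrentiev_homeomorphism:
  assumes X: "completely_metrizable_space X" and Y: "completely_metrizable_space Y"
    and S: "S \<subseteq> topspace X" and T: "T \<subseteq> topspace Y"
    and f: "homeomorphic_map (subtopology X S) (subtopology Y T) f"
  obtains A B F where "gdelta_in X A" "gdelta_in Y B" "S \<subseteq> A" "T \<subseteq> B"
    "homeomorphic_map (subtopology X A) (subtopology Y B) F" "\<And>x. x \<in> S \<Longrightarrow> F x = f x"
proof -
  obtain g where fg: "homeomorphic_maps (subtopology X S) (subtopology Y T) f g"
    using f homeomorphic_map_maps by blast
  then have contf: "continuous_map (subtopology X S) Y f" and contg: "continuous_map (subtopology Y T) X g"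
    and gf: "\<And>x. x \<in> S \<Longrightarrow> g (f x) = x" and fS: "f ` S = T"
    using S T homeomorphic_imp_surjective_map[OF f]
    by (auto simp: homeomorphic_maps_def continuous_map_in_subtopology Int_absorb1)
  obtain U F where U: "gdelta_in X U" "S \<subseteq> U" "U \<subseteq> X closure_of S"
      "continuous_map (subtopology X U) Y F" "\<And>x. x \<in> S \<Longrightarrow> F x = f x"
    using Lavrentiev_extension[OF S _ Y contf] completely_metrizable_imp_metrizable_space[OF X]
    by blast
  obtain V G where V: "gdelta_in Y V" "T \<subseteq> V" "V \<subseteq> Y closure_of T"
      "continuous_map (subtopology Y V) X G" "\<And>y. y \<in> T \<Longrightarrow> G y = g y"
    using Lavrentiev_extension[OF T _ X contg] completely_metrizable_imp_metrizable_space[OF Y]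
    by blast
  define A where "A = {x \<in> U. F x \<in> V}"
  have Utop: "U \<subseteq> topspace X" using U(1) gdelta_in_subset by blast
  have "gdelta_in (subtopology X U) A"
  proof -
    have "gdelta_in (subtopology X U) {x \<in> topspace (subtopology X U). F x \<in> V}"
      using U(4) V(1) by (rule gdelta_in_preimage)
    then show ?thesis using Utop by (simp add: A_def Int_absorb1)
  qed
  then have A: "gdelta_in X A" using gdelta_in_gdelta_subtopology[OF U(1)] by blast
  have SA: "S \<subseteq> A" using U V fS by (auto simp: A_def)
  have contF: "continuous_map (subtopology X A) (subtopology Y V) F"
    using U(4) by (auto simp: A_def continuous_map_in_subtopology
        intro: continuous_map_from_subtopology_mono)
  have GF: "G (F x) = x" if "x \<in> A" for x
  proof (rule forall_in_closure_of_eq)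
    show "x \<in> subtopology X A closure_of S"
      using that U(3) SA by (auto simp: closure_of_subtopology A_def Int_absorb1)
    show "Hausdorff_space X"
      using X completely_metrizable_imp_metrizable_space metrizable_imp_Hausdorff_space by blast
    show "continuous_map (subtopology X A) X (\<lambda>x. G (F x))"
      using continuous_map_compose[OF contF V(4)] by (simp add: o_def)
    show "continuous_map (subtopology X A) X (\<lambda>x. x)"
      by (simp add: continuous_map_from_subtopology)
    show "G (F y) = y" if "y \<in> S" for y using that U V gf fS by force
  qed
  have "homeomorphic_maps (subtopology X A) (subtopology Y (F ` A)) F G"
    unfolding homeomorphic_maps_def
  proof (intro conjI ballI)
    show "continuous_map (subtopology X A) (subtopology Y (F ` A)) F"
      using contF by (auto simp: continuous_map_in_subtopology)
    have "F ` A \<subseteq> V" by (auto simp: A_def)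
    then show "continuous_map (subtopology Y (F ` A)) (subtopology X A) G"
      using V(4) GF by (auto simp: continuous_map_in_subtopology 
          intro: continuous_map_from_subtopology_mono)
  qed (use GF in auto)
  then have hom: "homeomorphic_map (subtopology X A) (subtopology Y (F ` A)) F"
    using homeomorphic_map_maps by blast
  have "gdelta_in Y (F ` A)"
    unfolding gdelta_in_eq_completely_metrizable_space[OF Y]
  proof
    show "F ` A \<subseteq> topspace Y" using V(1) gdelta_in_subset by (fastforce simp: A_def)
    show "completely_metrizable_space (subtopology Y (F ` A))"
      using homeomorphic_completely_metrizable_space[OF homeomorphic_map_imp_homeomorphic_space[OF hom]]
        completely_metrizable_space_gdelta_in[OF X A] by blast
  qed
  moreover have "T \<subseteq> F ` A" using SA U(5) fS by force
  ultimately show ?thesis using that A SA hom U(5) by blast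
qed

section \<open>Maps with one-point fibres off a countable set\<close>

text \<open>This makes \<open>p\<close> irreducible: the image of a proper closed set is a proper (closed) subset. It
  transfers density statements from the target of \<open>p\<close> to its source.\<close>

lemma irreducible_preimage:
  fixes p :: "cantor \<Rightarrow> cantor"
  assumes cont: "continuous_on UNIV p"
    and fibre: "\<And>x. x \<notin> D \<Longrightarrow> \<exists>z. p -` {x} = {z}"
    and count: "countable (p -` D)"
    and V: "open V" "V \<noteq> {}"
  obtains U where "open U" "U \<noteq> {}" "p -` U \<subseteq> V"
proof -
  have "\<not> V \<subseteq> p -` D"
    using open_subset_meager_imp_empty[OF countable_imp_meager[OF count] V(1)] V(2) by blast
  then obtain z where z: "z \<in> V" "p z \<notin> D" by blast
  have "compactin euclidean (- V)"
    using closedin_compact_space[OF compact_Hausdorff_cantor(1), of "- V"] V(1) closed_Compl[of V]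
    by simp
  then have "compactin euclidean (p ` (- V))"
    using image_compactin[of euclidean "- V" euclidean p] cont by simp
  then have "closed (p ` (- V))"
    using compactin_imp_closedin[OF compact_Hausdorff_cantor(2)] by simp
  then have "open (- p ` (- V))" by (simp add: open_closed)
  moreover have "p z \<in> - p ` (- V)"
  proof
    assume "p z \<in> p ` (- V)"
    then obtain w where "w \<notin> V" "p w = p z" by force
    moreover obtain u where "p -` {p z} = {u}" using fibre z(2) by blast
    ultimately show False using z(1) by (metis singletonD vimage_singleton_eq)
  qed
  ultimately show ?thesis using that[of "- p ` (- V)"] by blast
qed

text \<open>By compactness \<open>p\<close> is a closed map, and so is its restriction to a full preimage.\<close>

lemma homeomorphic_map_bijective_preimage:
  fixes p :: "cantor \<Rightarrow> cantor"
  assumes cont: "continuous_on UNIV p"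
    and fibre: "\<And>x. x \<in> E \<Longrightarrow> \<exists>z. p -` {x} = {z}"
  shows "homeomorphic_map (top_of_set (p -` E)) (top_of_set E) p"
proof (rule bijective_closed_imp_homeomorphic_map)
  have "closed_map euclidean euclidean p"
    using cont compact_Hausdorff_cantor by (intro T1_Spaces.continuous_imp_closed_map) auto
  then show "closed_map (top_of_set (p -` E)) (top_of_set E) p"
    by (rule closed_map_restriction) auto
  show "continuous_map (top_of_set (p -` E)) (top_of_set E) p"
    using cont by (auto simp: continuous_map_in_subtopology intro: continuous_on_subset)
  have "\<exists>z. p z = x" if "x \<in> E" for x using fibre[OF that] by blast
  then show "p ` topspace (top_of_set (p -` E)) = topspace (top_of_set E)" by fastforce
  show "inj_on p (topspace (top_of_set (p -` E)))"
  proof (rule inj_onI)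
    fix z w assume *: "z \<in> topspace (top_of_set (p -` E))" "p z = p w"
    then obtain u where "p -` {p z} = {u}" using fibre[of "p z"] by auto
    then show "z = w" using *(2) by (metis singletonD vimage_singleton_eq)
  qed
qed

text \<open>Only countably many points of \<open>A\<close> are removed, because \<open>G\<close> is injective. Off \<open>D\<close> the map \<open>p\<close> is a
  homeomorphism, and its images of \<open>G\<^sub>\<delta>\<close> sets are again \<open>G\<^sub>\<delta>\<close> by complete metrizability.\<close>

lemma push_down_gdelta_homeo:
  fixes p G :: "cantor \<Rightarrow> cantor"
  assumes p: "continuous_on UNIV p"
    and fibre: "\<And>x. x \<notin> D \<Longrightarrow> \<exists>z. p -` {x} = {z}"
    and countpD: "countable (p -` D)"
    and A: "gdelta_in euclidean A"
    and G: "homeomorphic_map (top_of_set A) (top_of_set B) G"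
    and A1_def: "A1 = {x \<in> A. p x \<notin> D \<and> p (G x) \<notin> D}"
  obtains k where "(p ` A1, p ` G ` A1, k) \<in> gdelta_homeos"
    "\<And>x. x \<in> A1 \<Longrightarrow> k (p x) = p (G x)" "countable (A - A1)"
proof -
  have p_hom: "homeomorphic_map (top_of_set (p -` (- D))) (top_of_set (- D)) p"
    by (intro homeomorphic_map_bijective_preimage p fibre) blast
  have injG: "inj_on G A"
    using homeomorphic_imp_injective_map[OF G] by simp
  define N where "N = p -` D \<union> {x \<in> A. p (G x) \<in> D}"
  have "countable (G ` {x \<in> A. p (G x) \<in> D})"
    by (rule countable_subset[OF _ countpD]) auto
  then have "countable {x \<in> A. p (G x) \<in> D}"
    using inj_on_subset[OF injG] countable_image_inj_on by (metis (no_types, lifting) mem_Collect_eq subsetI)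
  then have countN: "countable N" using countpD by (simp add: N_def)
  have A1N: "A1 = A - N" by (auto simp: A1_def N_def)
  have "fsigma_in euclidean (\<Union>x\<in>N. {x})"
    using countN closed_singleton_cantor
    by (intro fsigma_in_Union) (auto intro!: closed_imp_fsigma_in)
  then have A1_gdelta: "gdelta_in euclidean A1"
    unfolding A1N by (intro gdelta_in_diff A) simp
  define A2 where "A2 = p ` A1"
  define B2 where "B2 = p ` G ` A1"
  have p_A1: "homeomorphic_map (top_of_set A1) (top_of_set A2) p"
    and p_B1: "homeomorphic_map (top_of_set (G ` A1)) (top_of_set B2) p"
  proof -
    have *: "homeomorphic_map (top_of_set K) (top_of_set (p ` K)) p" if "p ` K \<subseteq> - D" for K
    proof -
      have "homeomorphic_map (subtopology (top_of_set (p -` (- D))) K) (subtopology (top_of_set (- D)) (p ` K)) p"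
        using that by (intro homeomorphic_map_subtopologies[OF p_hom]) auto
      moreover have "p -` (- D) \<inter> K = K" "- D \<inter> p ` K = p ` K" using that by auto
      ultimately show ?thesis by (simp add: subtopology_subtopology)
    qed
    show "homeomorphic_map (top_of_set A1) (top_of_set A2) p"
      "homeomorphic_map (top_of_set (G ` A1)) (top_of_set B2) p"
      unfolding A2_def B2_def by (rule *, force simp: A1_def)+
  qed
  have G_A1: "homeomorphic_map (top_of_set A1) (top_of_set (G ` A1)) G"
  proof -
    have "homeomorphic_map (subtopology (top_of_set A) A1) (subtopology (top_of_set B) (G ` A1)) G"
      using homeomorphic_imp_surjective_map[OF G]
      by (intro homeomorphic_map_subtopologies[OF G]) (auto simp: A1_def)
    moreover have "A \<inter> A1 = A1" "B \<inter> G ` A1 = G ` A1"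
      using homeomorphic_imp_surjective_map[OF G] by (auto simp: A1_def)
    ultimately show ?thesis by (simp add: subtopology_subtopology)
  qed
  have gdelta_image: "gdelta_in euclidean K'" 
    if "gdelta_in euclidean K" "homeomorphic_map (top_of_set K) (top_of_set K') f" 
    for K K' :: "cantor set" and f :: "cantor \<Rightarrow> cantor"
    using that homeomorphic_completely_metrizable_space[OF homeomorphic_map_imp_homeomorphic_space[OF that(2)]]
    by (simp add: gdelta_in_eq_completely_metrizable_space[OF completely_metrizable_cantor])
  have A2_gdelta: "gdelta_in euclidean A2" using A1_gdelta p_A1 by (rule gdelta_image)
  have B2_gdelta: "gdelta_in euclidean B2"
    using gdelta_image[OF A1_gdelta G_A1] p_B1 by (rule gdelta_image)
  obtain f where f: "homeomorphic_maps (top_of_set A1) (top_of_set A2) p f"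
    using p_A1 homeomorphic_map_maps by blast
  then have f_hom: "homeomorphic_map (top_of_set A2) (top_of_set A1) f"
    and fp: "\<And>x. x \<in> A1 \<Longrightarrow> f (p x) = x" by (auto simp: homeomorphic_maps_map)
  define k where "k = p \<circ> (G \<circ> f)"
  have k_hom: "homeomorphic_map (top_of_set A2) (top_of_set B2) k"
    unfolding k_def by (intro homeomorphic_map_compose[OF _ p_B1] homeomorphic_map_compose[OF f_hom G_A1])
  have kp: "k (p x) = p (G x)" if "x \<in> A1" for x using fp that by (simp add: k_def)
  show ?thesis
  proof
    show "(p ` A1, p ` G ` A1, k) \<in> gdelta_homeos"
      using A2_gdelta B2_gdelta k_hom by (simp add: gdelta_homeos_def A2_def B2_def)
    show "countable (A - A1)"
      by (rule countable_subset[OF _ countN]) (auto simp: A1N)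
  qed (rule kp)
qed

section \<open>Rigidity of the complement\<close>

lemma continuous_maps_agree_on_closure:
  fixes f g :: "'a::topological_space \<Rightarrow> cantor"
  assumes f: "continuous_on A f" and g: "continuous_on A g" and B: "B \<subseteq> A" "A \<subseteq> closure B"
    and eq: "\<And>x. x \<in> B \<Longrightarrow> f x = g x" and "x \<in> A"
  shows "f x = g x"
proof (rule forall_in_closure_of_eq)
  show "x \<in> Abstract_Topology.closure_of (top_of_set A) B"
    using assms by (auto simp: closure_of_subtopology Int_absorb1 euclidean_closure_of)
  show "continuous_map (top_of_set A) euclidean f" "continuous_map (top_of_set A) euclidean g"
    using f g by auto
qed (use eq compact_Hausdorff_cantor(2) in auto)

theorem theorem5:
  fixes X Y D :: "cantor set"
    and H :: "(cantor \<Rightarrow> cantor) set"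
  assumes Y: "Y = UNIV - X"
    and H: "subgroup H (homeo_group euclidean)"
    and D: "countable D" "closure D = UNIV" "D \<subseteq> Y" "D \<inter> eventually_constant = {}"
    and 1: "saturation H X = X"
    and 2: "\<And>h. h \<in> H - {id} \<Longrightarrow> h ` D \<inter> D = {}"
    and 3: "\<And>A B g. (A, B, g) \<in> gdelta_homeos \<Longrightarrow>
              (\<And>S. subgroup S ((homeo_group euclidean)\<lparr>carrier := H\<rparr>) \<Longrightarrow> |S| <o add_meager \<Longrightarrow>
                 |{x \<in> A. g x \<notin> point_orbit S x}| =o continuum) \<Longrightarrow>
              \<exists>z \<in> A \<inter> X. g z \<notin> X"
  shows "\<exists>Xstar :: cantor set.
           Xstar homeomorphic X \<and>
           closure (UNIV - Xstar) = UNIV \<and>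
           rigid_space (top_of_set (UNIV - Xstar))"
proof -
  have H_cont: "continuous_on UNIV h" if "h \<in> H" for h
  proof -
    have "homeomorphic_map euclidean euclidean h"
      using subgroup.subset[OF H] that unfolding homeo_group_euclidean by blast
    from homeomorphic_imp_continuous_map[OF this] show ?thesis by simp
  qed
  have "D \<noteq> {}" using D(2) by auto
  then have range: "range (from_nat_into D) = D" using D(1) by (rule range_from_nat_into)
  obtain p :: "cantor \<Rightarrow> cantor" where p: "continuous_on UNIV p"
    and fibre1: "\<And>x. x \<notin> D \<Longrightarrow> \<exists>z. p -` {x} = {z}"
    and fibre2: "\<And>x. x \<in> D \<Longrightarrow> \<exists>z w. z \<noteq> w \<and> p -` {x} = {z, w}"
    by (rule split_points_of_cantor[of "from_nat_into D", unfolded range]) (rule that)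
  have surj: "\<exists>z. p z = x" for x
  proof -
    have "\<exists>z. z \<in> p -` {x}"
    proof (cases "x \<in> D")
      case True
      then obtain z w where "p -` {x} = {z, w}" using fibre2 by meson
      then show ?thesis by blast
    next
      case False
      then obtain z where "p -` {x} = {z}" using fibre1 by meson
      then show ?thesis by simp
    qed
    then show ?thesis by auto
  qed
  have "p -` D = (\<Union>x\<in>D. p -` {x})" by blast
  moreover have "countable (p -` {x})" if "x \<in> D" for x
    using fibre2[OF that] by auto
  ultimately have countpD: "countable (p -` D)" using D(1) by simp
  note small = irreducible_preimage[OF p fibre1 countpD]
  define W where "W = p -` Y"
  have XD: "X \<inter> D = {}" using D(3) Y by blast
  have W: "UNIV - p -` X = W" by (auto simp: W_def Y)
  have dense_W: "closure W = UNIV"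
  proof (rule ccontr)
    assume "closure W \<noteq> UNIV"
    then obtain U where U: "open U" "U \<noteq> {}" "p -` U \<subseteq> - closure W"
      using small[of "- closure W"] by (auto simp: open_Compl)
    then obtain d where "d \<in> D" "d \<in> U"
      using D(2) open_Int_closure_eq_empty[of U D] by auto
    moreover obtain z where "p z = d" using surj by blast
    ultimately have "z \<in> W" "z \<in> - closure W" using D(3) U by (auto simp: W_def)
    then show False using closure_subset by blast
  qed
  have "homeomorphic_map (top_of_set (p -` X)) (top_of_set X) p"
    using XD by (intro homeomorphic_map_bijective_preimage p fibre1) blast
  then obtain q where "homeomorphic_maps (top_of_set (p -` X)) (top_of_set X) p q"
    using homeomorphic_map_maps by blast
  then have q: "continuous_on X q" "q ` X \<subseteq> p -` X" "\<And>z. z \<in> p -` X \<Longrightarrow> q (p z) = z"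
    "\<And>x. x \<in> X \<Longrightarrow> p (q x) = x"
    by (simp_all add: homeomorphic_maps_def continuous_map_in_subtopology image_subset_iff_funcset)
  have "homeomorphism (p -` X) X p q"
  proof (rule homeomorphismI)
    show "continuous_on (p -` X) p" using p by (rule continuous_on_subset) simp
  qed (use q in auto)
  then have hom: "(p -` X) homeomorphic X"
    unfolding homeomorphic_def by (intro exI)
  have inj_off_D: "z = w" if "p z = p w" "p z \<notin> D" for z w
    using fibre1[OF that(2)] that(1) by (metis singletonD vimage_singleton_eq)
  have identity: "g z = z" if g: "homeomorphic_map (top_of_set W) (top_of_set W) g" and "z \<in> W" for g z
  proof -
    obtain A B G where A: "gdelta_in euclidean A" "W \<subseteq> A" "W \<subseteq> B"
      and G: "homeomorphic_map (top_of_set A) (top_of_set B) G" and Gg: "\<And>x. x \<in> W \<Longrightarrow> G x = g x"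
      by (rule Lavrentiev_homeomorphism[OF completely_metrizable_cantor completely_metrizable_cantor _ _ g])
        auto
    have contG: "continuous_on A G" and injG: "inj_on G A"
      using homeomorphic_imp_continuous_map[OF G] homeomorphic_imp_injective_map[OF G]
      by (auto simp: continuous_map_in_subtopology)
    have GW: "G ` W = W"
      using homeomorphic_imp_surjective_map[OF g] Gg by (auto simp: image_def)
    \<comment> \<open>Cut \<open>G\<close> down to the part that lives off the split points and push it forward.\<close>
    define A1 where "A1 = {x \<in> A. p x \<notin> D \<and> p (G x) \<notin> D}"
    define A2 where "A2 = p ` A1"
    define B2 where "B2 = p ` G ` A1"
    obtain k where k: "(A2, B2, k) \<in> gdelta_homeos"
      and kp: "\<And>x. x \<in> A1 \<Longrightarrow> k (p x) = p (G x)" and countA: "countable (A - A1)"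
      by (rule push_down_gdelta_homeo[OF p _ countpD A(1) G A1_def, folded A2_def B2_def],
          erule fibre1, rule that)
    then have A2_gdelta: "gdelta_in euclidean A2"
      and k_hom: "homeomorphic_map (top_of_set A2) (top_of_set B2) k"
      by (auto simp: gdelta_homeos_def)
    have "closure A = UNIV" using dense_W closure_mono[OF A(2)] by auto
    then have "meager (- A \<union> (A - A1))"
      using A(1) countA by (intro meager_Un dense_gdelta_imp_comeager countable_imp_meager)
    then have A1_meets: "\<exists>x. x \<in> V \<inter> A1" if "open V" "V \<noteq> {}" for V
      using open_subset_meager_imp_empty[of "- A \<union> (A - A1)" V] that by blast
    \<comment> \<open>\<open>G\<close> is injective and maps \<open>W\<close> onto itself, so points outside \<open>W\<close> stay outside.\<close>
    have "k y \<in> X" if y: "y \<in> A2 \<inter> X" for y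
    proof -
      obtain x where x: "x \<in> A1" "y = p x" using y by (auto simp: A2_def)
      have "G x \<notin> W"
      proof
        assume "G x \<in> W"
        then obtain w where "w \<in> W" "G w = G x" using GW by (metis imageE)
        then have "w = x" using injG A(2) x(1) by (metis (no_types, lifting) A1_def inj_onD mem_Collect_eq subsetD)
        then show False using \<open>w \<in> W\<close> x y by (simp add: W_def Y)
      qed
      then show ?thesis using kp x by (simp add: W_def Y)
    qed
    with k obtain S where S: "subgroup S ((homeo_group euclidean)\<lparr>carrier := H\<rparr>)" "|S| <o add_meager"
      "\<not> |{x \<in> A2. k x \<notin> point_orbit S x}| =o continuum"
      using 3[of A2 B2 k] by blast
    have SH: "S \<subseteq> H" using subgroup.subset[OF S(1)] by simp
    have contk: "continuous_on A2 k"
      using homeomorphic_imp_continuous_map[OF k_hom] by (auto simp: continuous_map_in_subtopology)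
    have few: "\<not> |{x \<in> A2. \<forall>s\<in>S. k x \<noteq> s x}| =o continuum"
      using S(3) by (simp add: point_orbit_def saturation_def)
    have A2_meets: "\<exists>x\<in>A1. p x \<in> U" if "open U" "U \<noteq> {}" for U
      using A1_meets[of "p -` U"] that surj open_vimage[OF that(1) p] by blast
    have dense_A2: "closure A2 = UNIV"
    proof (rule ccontr)
      assume "closure A2 \<noteq> UNIV"
      then obtain x where "x \<in> A1" "p x \<in> - closure A2" using A2_meets[of "- closure A2"] by auto
      moreover have "p x \<in> closure A2"
        using \<open>x \<in> A1\<close> closure_subset[of A2] by (auto simp: A2_def)
      ultimately show False by simp
    qed
    have SC: "continuous_on UNIV s" if "s \<in> S" for s using H_cont SH that by blast
    \<comment> \<open>Locally \<open>k\<close> is an element of \<open>S\<close>, and this element must be the identity.\<close>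
    have locally: "\<exists>V. open V \<and> V \<noteq> {} \<and> V \<subseteq> U \<and> (\<forall>x\<in>A1. p x \<in> V \<longrightarrow> p (G x) = p x)"
      if "open U" "U \<noteq> {}" for U
    proof -
      note few_maps = locally_one_of_few_maps[OF A2_gdelta dense_A2 contk SC S(2) few that]
      obtain V s where V: "open V" "V \<noteq> {}" "V \<subseteq> U" "s \<in> S" "\<And>x. x \<in> V \<inter> A2 \<Longrightarrow> k x = s x"
        using few_maps by auto
      have pG: "p (G x) = s (p x)" if "x \<in> A1" "p x \<in> V" for x
        using V(5)[of "p x"] kp that by (simp add: A2_def)
      have "s = id"
      proof (rule ccontr)
        assume "s \<noteq> id"
        then have sD: "s ` D \<inter> D = {}" using 2[of s] V(4) SH by blast
        obtain d where d: "d \<in> D" "d \<in> V"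
          using D(2) V open_Int_closure_eq_empty[of V D] by auto
        obtain z w where zw: "z \<noteq> w" "p z = d" "p w = d" using fibre2[OF d(1)] by blast
        \<comment> \<open>The agreement extends by continuity from \<open>A1\<close> to \<open>A\<close>, in particular to both halves of \<open>d\<close>.\<close>
        have "p (G x) = s (p x)" if "x \<in> A \<inter> p -` V" for x
        proof (rule continuous_maps_agree_on_closure[OF _ _ _ _ _ that])
          show "continuous_on (A \<inter> p -` V) (\<lambda>x. p (G x))"
            by (rule continuous_on_compose2[OF p continuous_on_subset[OF contG]]) auto
          show "continuous_on (A \<inter> p -` V) (\<lambda>x. s (p x))"
            by (rule continuous_on_compose2[OF SC[OF V(4)] continuous_on_subset[OF p]]) auto
          show "A1 \<inter> p -` V \<subseteq> A \<inter> p -` V" by (auto simp: A1_def)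
          show "A \<inter> p -` V \<subseteq> closure (A1 \<inter> p -` V)"
          proof
            fix x assume x: "x \<in> A \<inter> p -` V"
            show "x \<in> closure (A1 \<inter> p -` V)"
            proof (rule ccontr)
              assume "x \<notin> closure (A1 \<inter> p -` V)"
              moreover have "open (p -` V)" using V(1) p by (rule open_vimage)
              ultimately have "\<exists>y. y \<in> (p -` V \<inter> - closure (A1 \<inter> p -` V)) \<inter> A1"
                using x by (intro A1_meets) auto
              then show False using closure_subset[of "A1 \<inter> p -` V"] by auto
            qed
          qed
        qed (use pG in auto)
        moreover have "z \<in> A" "w \<in> A" using zw d D(3) A(2) by (auto simp: W_def)
        ultimately have "p (G z) = s d" "p (G w) = s d" using zw d by auto
        moreover have "s d \<notin> D" using sD d by blast
        ultimately have "G z = G w" using inj_off_D by metis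
        then show False using injG zw(1) \<open>z \<in> A\<close> \<open>w \<in> A\<close> by (metis inj_onD)
      qed
      then show ?thesis using V pG by (intro exI[of _ V]) auto
    qed
    have "G z = z"
    proof (rule ccontr)
      assume "G z \<noteq> z"
      have "closedin (top_of_set A) {x \<in> topspace (top_of_set A). G x = x}"
        using contG compact_Hausdorff_cantor(2)
        by (intro closedin_continuous_maps_eq) auto
      then obtain K where K: "closed K" "{x \<in> A. G x = x} = A \<inter> K"
        by (auto simp: closedin_closed)
      have "z \<in> - K" using K(2) \<open>G z \<noteq> z\<close> \<open>z \<in> W\<close> A(2) by blast
      then obtain U where U: "open U" "U \<noteq> {}" "p -` U \<subseteq> - K"
        using small[of "- K"] K(1) by (metis empty_iff open_Compl)
      obtain V where V: "open V" "V \<noteq> {}" "V \<subseteq> U" "\<forall>x\<in>A1. p x \<in> V \<longrightarrow> p (G x) = p x"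
        using locally[OF U(1,2)] by blast
      obtain x where x: "x \<in> A1" "p x \<in> V" using A2_meets[OF V(1,2)] by blast
      have "x \<in> A" "p (G x) \<notin> D" using x(1) by (simp_all add: A1_def)
      moreover have "p (G x) = p x" using V(4) x by blast
      ultimately have "G x = x" using inj_off_D[of "G x" x] by simp
      then have "x \<in> {x \<in> A. G x = x}" using \<open>x \<in> A\<close> by blast
      then have "x \<in> K" unfolding K(2) by blast
      then show False using U(3) V(3) x(2) by blast
    qed
    then show ?thesis using Gg \<open>z \<in> W\<close> by simp
  qed
  have "rigid_space (top_of_set W)"
    unfolding rigid_space_def
  proof
    let ?G = "homeo_group (top_of_set W)"
    have one: "\<one>\<^bsub>?G\<^esub> = (\<lambda>x\<in>W. x)" by (simp add: homeo_group_def BijGroup_def)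
    show "{\<one>\<^bsub>?G\<^esub>} \<subseteq> carrier ?G"
      using group.is_monoid[OF group_homeo_group] monoid.one_closed by blast
    show "carrier ?G \<subseteq> {\<one>\<^bsub>?G\<^esub>}"
    proof
      fix h assume "h \<in> carrier ?G"
      then have h: "h \<in> extensional W" "homeomorphic_map (top_of_set W) (top_of_set W) h"
        by (auto simp: homeo_group_def)
      have "h = (\<lambda>x\<in>W. x)"
        using h(1) identity[OF h(2)] by (intro extensionalityI[of _ W]) auto
      then show "h \<in> {\<one>\<^bsub>?G\<^esub>}" by (simp add: one)
    qed
  qed
  then show ?thesis using hom dense_W W by metis
qed

end
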